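(* Let $S$ be a semigroup. Then: (1) $S$ is regular if and only if $S$ satisfies $(\forall a)(\exists x)\colon a=axa$; (2) $S$ is a left group if and only if $S$ satisfies $(\forall a,b)(\exists x)\colon a=axb$; and $S$ is a right group if and only if $S$ satisfies $(\forall a,b)(\exists x)\colon a=bxa$; (3) $S$ is a group if and only if $S$ satisfies $(\forall a,b)(\exists x)\colon a=bxb$; (4) $S$ is completely regular if and only if $S$ satisfies $(\forall a)(\exists x)\colon a=a^2xa^2$; (5) $S$ is completely simple if and only if $S$ satisfies $(\forall a,b)(\exists x)\colon a=abxba$. (Thus each of these classes of semigroups is an EHP-class, defined by the indicated equation.)
   Context: Semigroups are non-empty. $V(a)=\{x\in S: a=axa,\ x=xax\}$ is the set of inverses of $a$; $S$ is regular if $V(a)\neq\varnothing$ for all $a\in S$. A semigroup is left simple if it consists of a single $\mathscr{L}$-class, i.e. $Sb=S$ for all $b\in S$; a left group is a left simple semigroup that is regular (equivalently, left simple and right cancellative). Right groups are the left-right duals. A semigroup is completely regular if it is a union of groups (every element lies in a subgroup). A completely simple semigroup is a simple completely regular semigroup, where simple means having a single $\mathscr{J}$-class. An EHP-class is a class of all semigroups satisfying some set of equation systems, an equation system being a sentence made of a finite string of quantifiers $\forall,\exists$ followed by a finite conjunction of equalities between semigroup words in the quantified symbols. *)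

theory Defs
  imports "HOL-Algebra.Group"
begin

record 'a magma = "'a partial_object" +
  mul :: "'a \<Rightarrow> 'a \<Rightarrow> 'a"  (infixl \<open>\<cdot>\<index>\<close> 70)

definition is_semigroup :: "'a magma \<Rightarrow> bool" where
  "is_semigroup S \<longleftrightarrow>
     carrier S \<noteq> {} \<and>
     (\<forall>x\<in>carrier S. \<forall>y\<in>carrier S. x \<cdot>\<^bsub>S\<^esub> y \<in> carrier S) \<and>
     (\<forall>x\<in>carrier S. \<forall>y\<in>carrier S. \<forall>z\<in>carrier S.
        (x \<cdot>\<^bsub>S\<^esub> y) \<cdot>\<^bsub>S\<^esub> z = x \<cdot>\<^bsub>S\<^esub> (y \<cdot>\<^bsub>S\<^esub> z))"

definition opposite :: "'a magma \<Rightarrow> 'a magma" where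
  "opposite S = \<lparr>carrier = carrier S, mul = (\<lambda>x y. y \<cdot>\<^bsub>S\<^esub> x)\<rparr>"

definition is_group :: "'a magma \<Rightarrow> bool" where
  "is_group S \<longleftrightarrow> (\<exists>e. group \<lparr>carrier = carrier S, monoid.mult = mul S, one = e\<rparr>)"

text \<open>The identity of a subgroup need not be an identity of the ambient semigroup.\<close>

definition is_subgroup :: "'a set \<Rightarrow> 'a magma \<Rightarrow> bool" where
  "is_subgroup H S \<longleftrightarrow> H \<subseteq> carrier S \<and> is_group \<lparr>carrier = H, mul = mul S\<rparr>"

definition inverses :: "'a magma \<Rightarrow> 'a \<Rightarrow> 'a set" where
  "inverses S a = {x \<in> carrier S. a = a \<cdot>\<^bsub>S\<^esub> x \<cdot>\<^bsub>S\<^esub> a \<and> x = x \<cdot>\<^bsub>S\<^esub> a \<cdot>\<^bsub>S\<^esub> x}"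

definition regular :: "'a magma \<Rightarrow> bool" where
  "regular S \<longleftrightarrow> (\<forall>a\<in>carrier S. inverses S a \<noteq> {})"

text \<open>The principal ideals \<open>S\<^sup>1 a\<close> and \<open>S\<^sup>1 a S\<^sup>1\<close>, without adjoining an identity to \<open>S\<close>.\<close>

definition left_ideal :: "'a magma \<Rightarrow> 'a \<Rightarrow> 'a set" where
  "left_ideal S a = {a} \<union> {x \<cdot>\<^bsub>S\<^esub> a | x. x \<in> carrier S}"

definition two_sided_ideal :: "'a magma \<Rightarrow> 'a \<Rightarrow> 'a set" where
  "two_sided_ideal S a =
     {a} \<union> {x \<cdot>\<^bsub>S\<^esub> a | x. x \<in> carrier S} \<union> {a \<cdot>\<^bsub>S\<^esub> y | y. y \<in> carrier S}
       \<union> {x \<cdot>\<^bsub>S\<^esub> a \<cdot>\<^bsub>S\<^esub> y | x y. x \<in> carrier S \<and> y \<in> carrier S}"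

definition green_L :: "'a magma \<Rightarrow> ('a \<times> 'a) set" where
  "green_L S = {(a, b) \<in> carrier S \<times> carrier S. left_ideal S a = left_ideal S b}"

definition green_J :: "'a magma \<Rightarrow> ('a \<times> 'a) set" where
  "green_J S = {(a, b) \<in> carrier S \<times> carrier S. two_sided_ideal S a = two_sided_ideal S b}"

definition left_simple :: "'a magma \<Rightarrow> bool" where
  "left_simple S \<longleftrightarrow> (\<forall>a\<in>carrier S. \<forall>b\<in>carrier S. (a, b) \<in> green_L S)"

lemma left_simple_iff:
  assumes "is_semigroup S"
  shows "left_simple S \<longleftrightarrow> (\<forall>b\<in>carrier S. (\<lambda>x. x \<cdot>\<^bsub>S\<^esub> b) ` carrier S = carrier S)"
proof
  assume ls: "left_simple S"
  show "\<forall>b\<in>carrier S. (\<lambda>x. x \<cdot>\<^bsub>S\<^esub> b) ` carrier S = carrier S"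
  proof
    fix b assume b: "b \<in> carrier S"
    have closed: "x \<cdot>\<^bsub>S\<^esub> y \<in> carrier S" if "x \<in> carrier S" "y \<in> carrier S" for x y
      using assms that by (auto simp: is_semigroup_def)
    have "a \<in> (\<lambda>x. x \<cdot>\<^bsub>S\<^esub> b) ` carrier S" if a: "a \<in> carrier S" for a
    proof -
      have in_ideal: "a \<in> left_ideal S (b \<cdot>\<^bsub>S\<^esub> b)"
      proof -
        have "(a, b \<cdot>\<^bsub>S\<^esub> b) \<in> green_L S"
          using ls a closed[OF b b] unfolding left_simple_def by blast
        then have "left_ideal S a = left_ideal S (b \<cdot>\<^bsub>S\<^esub> b)"
          unfolding green_L_def by simp
        moreover have "a \<in> left_ideal S a" by (simp add: left_ideal_def)
        ultimately show ?thesis by blast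
      qed
      from in_ideal consider "a = b \<cdot>\<^bsub>S\<^esub> b" | x where "x \<in> carrier S" "a = x \<cdot>\<^bsub>S\<^esub> (b \<cdot>\<^bsub>S\<^esub> b)"
        unfolding left_ideal_def by blast
      then show ?thesis
      proof cases
        case 1
        with b show ?thesis by blast
      next
        case (2 x)
        have "(x \<cdot>\<^bsub>S\<^esub> b) \<cdot>\<^bsub>S\<^esub> b = x \<cdot>\<^bsub>S\<^esub> (b \<cdot>\<^bsub>S\<^esub> b)"
          using assms b 2(1) unfolding is_semigroup_def by blast
        then have "a = (x \<cdot>\<^bsub>S\<^esub> b) \<cdot>\<^bsub>S\<^esub> b"
          using 2(2) by (rule trans[OF _ sym, rotated])
        with closed[OF 2(1) b] show ?thesis by blast
      qed
    qed
    then show "(\<lambda>x. x \<cdot>\<^bsub>S\<^esub> b) ` carrier S = carrier S"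
      using b closed by blast
  qed
next
  assume all: "\<forall>b\<in>carrier S. (\<lambda>x. x \<cdot>\<^bsub>S\<^esub> b) ` carrier S = carrier S"
  have "left_ideal S b = carrier S" if "b \<in> carrier S" for b
  proof -
    have "left_ideal S b = {b} \<union> (\<lambda>x. x \<cdot>\<^bsub>S\<^esub> b) ` carrier S"
      by (auto simp: left_ideal_def)
    also have "\<dots> = {b} \<union> carrier S" using all that by blast
    also have "\<dots> = carrier S" using that by blast
    finally show ?thesis .
  qed
  then show "left_simple S"
    by (simp add: left_simple_def green_L_def)
qed

definition left_group :: "'a magma \<Rightarrow> bool" where
  "left_group S \<longleftrightarrow> left_simple S \<and> regular S"

definition right_group :: "'a magma \<Rightarrow> bool" where
  "right_group S \<longleftrightarrow> left_group (opposite S)"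

definition completely_regular :: "'a magma \<Rightarrow> bool" where
  "completely_regular S \<longleftrightarrow> (\<forall>a\<in>carrier S. \<exists>H. is_subgroup H S \<and> a \<in> H)"

definition simple_semigroup :: "'a magma \<Rightarrow> bool" where
  "simple_semigroup S \<longleftrightarrow> (\<forall>a\<in>carrier S. \<forall>b\<in>carrier S. (a, b) \<in> green_J S)"

definition completely_simple :: "'a magma \<Rightarrow> bool" where
  "completely_simple S \<longleftrightarrow> simple_semigroup S \<and> completely_regular S"

text \<open>
  An equation system consists of a string of quantifiers and a conjunction of word equations.
  The quantified symbols are named by position: the number \<open>i\<close> in a word is the symbol bound by
  the \<open>i\<close>-th quantifier, counting from 0. For example, \<open>(\<forall>a)(\<exists>x): a = axa\<close> is
  \<open>Eq_System [Forall, Exists] [([0], [0, 1, 0])]\<close>.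
\<close>

datatype quantifier = Forall | Exists

datatype eq_system = Eq_System "quantifier list" "(nat list \<times> nat list) list"

text \<open>Semigroup words are non-empty, and all their symbols are quantified.\<close>

fun wf_system :: "eq_system \<Rightarrow> bool" where
  "wf_system (Eq_System qs eqs) \<longleftrightarrow>
     (\<forall>(u, v)\<in>set eqs. u \<noteq> [] \<and> v \<noteq> [] \<and> set u \<union> set v \<subseteq> {..<length qs})"

text \<open>The empty word has no specified value; \<open>wf_system\<close> excludes it.\<close>

fun word_value :: "'a magma \<Rightarrow> 'a list \<Rightarrow> nat list \<Rightarrow> 'a" where
  "word_value S env [i] = env ! i"
| "word_value S env (i # j # w) = (env ! i) \<cdot>\<^bsub>S\<^esub> word_value S env (j # w)"

fun holds :: "'a magma \<Rightarrow> (nat list \<times> nat list) list \<Rightarrow> quantifier list \<Rightarrow> 'a list \<Rightarrow> bool" where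
  "holds S eqs [] env \<longleftrightarrow> (\<forall>(u, v)\<in>set eqs. word_value S env u = word_value S env v)"
| "holds S eqs (Forall # qs) env \<longleftrightarrow> (\<forall>a\<in>carrier S. holds S eqs qs (env @ [a]))"
| "holds S eqs (Exists # qs) env \<longleftrightarrow> (\<exists>a\<in>carrier S. holds S eqs qs (env @ [a]))"

fun satisfies :: "'a magma \<Rightarrow> eq_system \<Rightarrow> bool" where
  "satisfies S (Eq_System qs eqs) \<longleftrightarrow> holds S eqs qs []"

text \<open>
  \<open>EHP_class_by \<Sigma> C\<close>: \<open>C\<close> is the EHP-class defined by \<open>\<Sigma>\<close>. In HOL a class of semigroups is
  restricted to carriers inside one type \<open>'a\<close>. Equation systems do not mention \<open>'a\<close>, so for a
  given \<open>\<Sigma>\<close> a statement polymorphic in \<open>'a\<close> covers all semigroups with the same \<open>\<Sigma>\<close>.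
\<close>

definition EHP_class_by :: "eq_system set \<Rightarrow> 'a magma set \<Rightarrow> bool" where
  "EHP_class_by \<Sigma> C \<longleftrightarrow>
     (\<forall>E\<in>\<Sigma>. wf_system E) \<and> C = {S. is_semigroup S \<and> (\<forall>E\<in>\<Sigma>. satisfies S E)}"

definition EHP_class :: "'a magma set \<Rightarrow> bool" where
  "EHP_class C \<longleftrightarrow> (\<exists>\<Sigma>. EHP_class_by \<Sigma> C)"

end

(* Complete regularity is an equation because a = a^2 x a^2 gives z = a x a with a z = z a and
   a z a = a, so that a is a unit of the local monoid e S e with e = a z. For completely simple
   semigroups, simplicity gives a = u a w with w = b v, and w = w^2 x w^2 turns this into
   a = a (w x w^2), an element of a b S; dually a lies in S b a, and regularity joins the two. *)
theory Submission
  imports Defs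
begin

section \<open>Regularity and one-sided groups\<close>

text \<open>A locale, so that its lemmas can also be instantiated at \<open>opposite S\<close> and
  at a subgroup with restricted carrier.\<close>

locale magma_semigroup =
  fixes S :: "'a magma" (structure)
  assumes semigroup: "is_semigroup S"
begin

lemma nonempty: "carrier S \<noteq> {}"
  using semigroup by (simp add: is_semigroup_def)

lemma closed [simp, intro]:
  "x \<in> carrier S \<Longrightarrow> y \<in> carrier S \<Longrightarrow> x \<cdot> y \<in> carrier S"
  using semigroup by (simp add: is_semigroup_def)

lemma assoc:
  "x \<in> carrier S \<Longrightarrow> y \<in> carrier S \<Longrightarrow> z \<in> carrier S \<Longrightarrow> x \<cdot> y \<cdot> z = x \<cdot> (y \<cdot> z)"
  using semigroup by (simp add: is_semigroup_def)

text \<open>If \<open>a = a x a\<close>, then \<open>x a x\<close> is an inverse of \<open>a\<close>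
  in the full, two-sided sense.\<close>

lemma regular_iff: "regular S \<longleftrightarrow> (\<forall>a\<in>carrier S. \<exists>x\<in>carrier S. a = a \<cdot> x \<cdot> a)"
proof
  assume "regular S"
  then show "\<forall>a\<in>carrier S. \<exists>x\<in>carrier S. a = a \<cdot> x \<cdot> a"
    unfolding regular_def inverses_def by blast
next
  assume R: "\<forall>a\<in>carrier S. \<exists>x\<in>carrier S. a = a \<cdot> x \<cdot> a"
  show "regular S"
    unfolding regular_def
  proof
    fix a assume a: "a \<in> carrier S"
    with R obtain x where x: "x \<in> carrier S" and axa: "a = a \<cdot> x \<cdot> a" by blast
    have 1: "a \<cdot> (x \<cdot> a) = a" using axa a x by (simp add: assoc)
    \<comment> \<open>\<open>assoc\<close> nests products to the right, so fact \<open>1\<close>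
      alone does not match inside a longer word; this version with a tail \<open>y\<close>
      does.\<close>
    have 2: "a \<cdot> (x \<cdot> (a \<cdot> y)) = a \<cdot> y" if "y \<in> carrier S" for y
      using arg_cong[OF 1, of "\<lambda>t. t \<cdot> y"] a x that by (simp add: assoc)
    have "x \<cdot> a \<cdot> x \<in> inverses S a"
      using a x by (simp add: inverses_def assoc 1 2)
    then show "inverses S a \<noteq> {}" by blast
  qed
qed

text \<open>Regularity gives \<open>a = a y a\<close>, and left simplicity rewrites
  \<open>y a\<close> as \<open>x b\<close>. Conversely, \<open>a = (a x) b\<close> yields
  \<open>S b = S\<close>, and the case \<open>b = a\<close> is regularity.\<close>

lemma left_group_iff:
  "left_group S \<longleftrightarrow> (\<forall>a\<in>carrier S. \<forall>b\<in>carrier S. \<exists>x\<in>carrier S. a = a \<cdot> x \<cdot> b)"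
proof
  assume L: "left_group S"
  show "\<forall>a\<in>carrier S. \<forall>b\<in>carrier S. \<exists>x\<in>carrier S. a = a \<cdot> x \<cdot> b"
  proof (intro ballI)
    fix a b assume a: "a \<in> carrier S" and b: "b \<in> carrier S"
    obtain y where y: "y \<in> carrier S" "a = a \<cdot> y \<cdot> a"
      using L a regular_iff unfolding left_group_def by blast
    have "y \<cdot> a \<in> (\<lambda>x. x \<cdot> b) ` carrier S"
      using L a b y(1) left_simple_iff[OF semigroup] unfolding left_group_def by blast
    then obtain x where x: "x \<in> carrier S" "y \<cdot> a = x \<cdot> b" by blast
    have "a = a \<cdot> x \<cdot> b"
      using a b x y by (simp add: assoc)
    with x(1) show "\<exists>x\<in>carrier S. a = a \<cdot> x \<cdot> b" by blast
  qed
next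
  assume R: "\<forall>a\<in>carrier S. \<forall>b\<in>carrier S. \<exists>x\<in>carrier S. a = a \<cdot> x \<cdot> b"
  have "a \<in> (\<lambda>x. x \<cdot> b) ` carrier S" if "a \<in> carrier S" "b \<in> carrier S" for a b
    using R that closed by blast
  then have "left_simple S"
    unfolding left_simple_iff[OF semigroup] by auto
  moreover have "regular S"
    unfolding regular_iff using R by blast
  ultimately show "left_group S" by (simp add: left_group_def)
qed

lemma opposite_semigroup: "magma_semigroup (opposite S)"
  using nonempty by unfold_locales (auto simp: is_semigroup_def opposite_def assoc)

text \<open>This is \<open>left_group_iff\<close> in the opposite semigroup, where the product
  \<open>a x b\<close> becomes \<open>b (x a)\<close>; associativity restores the
  bracketing.\<close>

lemma right_group_iff:
  "right_group S \<longleftrightarrow> (\<forall>a\<in>carrier S. \<forall>b\<in>carrier S. \<exists>x\<in>carrier S. a = b \<cdot> x \<cdot> a)"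
  unfolding right_group_def magma_semigroup.left_group_iff[OF opposite_semigroup]
  by (simp add: opposite_def assoc)

section \<open>Groups\<close>

text \<open>In a group, conjugating by inverses solves the equation: \<open>x\<close> is the inverse
  of \<open>b\<close>, times \<open>a\<close>, times the inverse of \<open>b\<close>. Conversely, if
  \<open>b = b x b\<close>, then \<open>b x\<close> fixes every element of \<open>b S b = S\<close>
  from the left, and solving \<open>b x = a z a\<close> makes \<open>a z\<close> a left inverse of
  \<open>a\<close>. A left identity with left inverses suffices for \<open>groupI\<close>.\<close>

lemma group_iff:
  "is_group S \<longleftrightarrow> (\<forall>a\<in>carrier S. \<forall>b\<in>carrier S. \<exists>x\<in>carrier S. a = b \<cdot> x \<cdot> b)"
proof
  assume "is_group S"
  then obtain e where "group \<lparr>carrier = carrier S, monoid.mult = mul S, one = e\<rparr>"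
    unfolding is_group_def by blast
  then interpret G: group "\<lparr>carrier = carrier S, monoid.mult = mul S, one = e\<rparr>" .
  show "\<forall>a\<in>carrier S. \<forall>b\<in>carrier S. \<exists>x\<in>carrier S. a = b \<cdot> x \<cdot> b"
  proof (intro ballI)
    fix a b assume a: "a \<in> carrier S" and b: "b \<in> carrier S"
    \<comment> \<open>The inverse of \<open>b\<close>, restated with the carrier and multiplication
      of \<open>S\<close>.\<close>
    obtain c where c: "c \<in> carrier S" "b \<cdot> c = e" "c \<cdot> b = e"
      using G.l_inv_ex[of b] G.r_inv_ex[of b] b
      by (metis G.inv_equality G.r_inv monoid.select_convs(1,2) partial_object.select_convs(1))
    have "b \<cdot> (c \<cdot> a \<cdot> c) \<cdot> b = (b \<cdot> c) \<cdot> a \<cdot> (c \<cdot> b)"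
      using a b c(1) by (simp add: assoc)
    also have "\<dots> = a"
      using G.l_one[of a] G.r_one[of a] a c by simp
    finally show "\<exists>x\<in>carrier S. a = b \<cdot> x \<cdot> b"
      using a c(1) by (intro bexI[of _ "c \<cdot> a \<cdot> c"]) auto
  qed
next
  assume R: "\<forall>a\<in>carrier S. \<forall>b\<in>carrier S. \<exists>x\<in>carrier S. a = b \<cdot> x \<cdot> b"
  \<comment> \<open>The identity has to be built from some element; any \<open>b\<close> will do,
    and non-emptiness provides one.\<close>
  obtain b where b: "b \<in> carrier S" using nonempty by blast
  obtain x where x: "x \<in> carrier S" "b = b \<cdot> x \<cdot> b" using R b by blast
  have left_one: "b \<cdot> x \<cdot> a = a" if a: "a \<in> carrier S" for a
  proof -
    obtain y where y: "y \<in> carrier S" "a = b \<cdot> y \<cdot> b" using R a b by blast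
    have "b \<cdot> x \<cdot> a = (b \<cdot> x \<cdot> b) \<cdot> y \<cdot> b"
      using b x(1) y by (simp add: assoc)
    also have "\<dots> = a" using x(2) y(2) by simp
    finally show ?thesis .
  qed
  have left_inv: "\<exists>y\<in>carrier S. y \<cdot> a = b \<cdot> x" if a: "a \<in> carrier S" for a
  proof -
    have "b \<cdot> x \<in> carrier S" using b x(1) by blast
    with R a obtain z where "z \<in> carrier S" "b \<cdot> x = a \<cdot> z \<cdot> a" by blast
    with a show ?thesis by (intro bexI[of _ "a \<cdot> z"]) auto
  qed
  have "group \<lparr>carrier = carrier S, monoid.mult = mul S, one = b \<cdot> x\<rparr>"
    by (rule groupI) (use b x(1) left_one left_inv in \<open>auto simp: assoc\<close>)
  then show "is_group S" unfolding is_group_def by blast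
qed

section \<open>Local unit groups and complete regularity\<close>

text \<open>For idempotent \<open>e\<close> this is the unit group of the local monoid
  \<open>e S e\<close>, hence the largest subgroup with identity \<open>e\<close>. Membership in
  \<open>e S e\<close> is expressed by absorbing \<open>e\<close> on both sides.\<close>

definition local_units :: "'a \<Rightarrow> 'a set" where
  "local_units e = {b \<in> carrier S. e \<cdot> b = b \<and> b \<cdot> e = b \<and>
     (\<exists>c\<in>carrier S. e \<cdot> c = c \<and> c \<cdot> e = c \<and> b \<cdot> c = e \<and> c \<cdot> b = e)}"

text \<open>Products stay inside because the reversed product \<open>d c\<close> of the inverses
  inverts \<open>a b\<close>. Inverses stay inside because the defining condition is symmetric in
  \<open>b\<close> and \<open>c\<close>.\<close>

lemma is_subgroup_local_units:
  assumes e: "e \<in> carrier S" "e \<cdot> e = e"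
  shows "is_subgroup (local_units e) S"
proof -
  have mult: "a \<cdot> b \<in> local_units e" if ab: "a \<in> local_units e" "b \<in> local_units e" for a b
  proof -
    from ab(1) obtain c where a: "a \<in> carrier S" "e \<cdot> a = a" "a \<cdot> e = a"
      and c: "c \<in> carrier S" "e \<cdot> c = c" "c \<cdot> e = c" "a \<cdot> c = e" "c \<cdot> a = e"
      unfolding local_units_def by blast
    from ab(2) obtain d where b: "b \<in> carrier S" "e \<cdot> b = b" "b \<cdot> e = b"
      and d: "d \<in> carrier S" "e \<cdot> d = d" "d \<cdot> e = d" "b \<cdot> d = e" "d \<cdot> b = e"
      unfolding local_units_def by blast
    have "a \<cdot> b \<cdot> (d \<cdot> c) = a \<cdot> (b \<cdot> d) \<cdot> c" "d \<cdot> c \<cdot> (a \<cdot> b) = d \<cdot> (c \<cdot> a) \<cdot> b"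
      using a(1) b(1) c(1) d(1) by (simp_all add: assoc)
    then have "a \<cdot> b \<cdot> (d \<cdot> c) = e" "d \<cdot> c \<cdot> (a \<cdot> b) = e"
      using a b c d by simp_all
    moreover have "e \<cdot> (a \<cdot> b) = a \<cdot> b" "e \<cdot> (d \<cdot> c) = d \<cdot> c"
      using assoc[of e a b] assoc[of e d c] a b c d e(1) by simp_all
    moreover have "a \<cdot> b \<cdot> e = a \<cdot> b" "d \<cdot> c \<cdot> e = d \<cdot> c"
      using a b c d e(1) by (simp_all add: assoc)
    ultimately show ?thesis
      unfolding local_units_def using a(1) b(1) c(1) d(1) by blast
  qed
  have "group \<lparr>carrier = local_units e, monoid.mult = mul S, one = e\<rparr>"
  proof (rule groupI)
    fix x assume "x \<in> carrier \<lparr>carrier = local_units e, monoid.mult = mul S, one = e\<rparr>"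
    then show "\<exists>y\<in>carrier \<lparr>carrier = local_units e, monoid.mult = mul S, one = e\<rparr>.
      y \<otimes>\<^bsub>\<lparr>carrier = local_units e, monoid.mult = mul S, one = e\<rparr>\<^esub> x
        = \<one>\<^bsub>\<lparr>carrier = local_units e, monoid.mult = mul S, one = e\<rparr>\<^esub>"
      unfolding local_units_def by auto
  qed (use e mult in \<open>auto simp: local_units_def assoc\<close>)
  then show ?thesis
    unfolding is_subgroup_def is_group_def by (auto simp: local_units_def)
qed

text \<open>Opens the locale on \<open>H\<close>, so that \<open>group_iff\<close> can be used
  inside a subgroup.\<close>

lemma subgroup_semigroup:
  assumes "is_subgroup H S"
  shows "magma_semigroup \<lparr>carrier = H, mul = mul S\<rparr>"
proof
  obtain e where G: "group \<lparr>carrier = H, monoid.mult = mul S, one = e\<rparr>" and H: "H \<subseteq> carrier S"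
    using assms unfolding is_subgroup_def is_group_def by auto
  interpret G: group "\<lparr>carrier = H, monoid.mult = mul S, one = e\<rparr>" by (rule G)
  show "is_semigroup \<lparr>carrier = H, mul = mul S\<rparr>"
    using G.one_closed G.m_closed H by (auto simp: is_semigroup_def subset_iff assoc)
qed

text \<open>Inside a subgroup containing \<open>a\<close>, \<open>group_iff\<close> applied to
  \<open>a\<close> and \<open>a a\<close> gives the equation. For the converse, \<open>a\<close> is
  placed in \<open>local_units e\<close> for a suitable idempotent \<open>e\<close>.\<close>

lemma completely_regular_iff:
  "completely_regular S \<longleftrightarrow> (\<forall>a\<in>carrier S. \<exists>x\<in>carrier S. a = a \<cdot> a \<cdot> x \<cdot> (a \<cdot> a))"
proof
  assume C: "completely_regular S"
  show "\<forall>a\<in>carrier S. \<exists>x\<in>carrier S. a = a \<cdot> a \<cdot> x \<cdot> (a \<cdot> a)"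
  proof
    fix a assume "a \<in> carrier S"
    with C obtain H where H: "is_subgroup H S" "a \<in> H"
      unfolding completely_regular_def by blast
    interpret H: magma_semigroup "\<lparr>carrier = H, mul = mul S\<rparr>"
      by (rule subgroup_semigroup[OF H(1)])
    have "a \<cdot> a \<in> H" using H.closed[of a a] H(2) by simp
    moreover have "\<forall>a\<in>H. \<forall>b\<in>H. \<exists>x\<in>H. a = b \<cdot> x \<cdot> b"
      using H.group_iff H(1) unfolding is_subgroup_def by simp
    ultimately obtain x where "x \<in> H" "a = a \<cdot> a \<cdot> x \<cdot> (a \<cdot> a)"
      using H(2) by blast
    with H(1) show "\<exists>x\<in>carrier S. a = a \<cdot> a \<cdot> x \<cdot> (a \<cdot> a)"
      unfolding is_subgroup_def by blast
  qed
next
  assume R: "\<forall>a\<in>carrier S. \<exists>x\<in>carrier S. a = a \<cdot> a \<cdot> x \<cdot> (a \<cdot> a)"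
  show "completely_regular S"
    unfolding completely_regular_def
  proof
    fix a assume a: "a \<in> carrier S"
    with R obtain x where x: "x \<in> carrier S" and axa: "a = a \<cdot> a \<cdot> x \<cdot> (a \<cdot> a)" by blast
    define z where "z = a \<cdot> x \<cdot> a"
    have z: "z \<in> carrier S" using a x by (simp add: z_def)
    have aza: "a \<cdot> z \<cdot> a = a" using axa a x by (simp add: z_def assoc)
    \<comment> \<open>Both \<open>z a\<close> and \<open>a z\<close> equal \<open>a z z a\<close>:
      expand the leading \<open>a\<close> of \<open>a x a a\<close>, respectively the trailing
      \<open>a\<close> of \<open>a a x a\<close>, to \<open>a z a\<close>.\<close>
    have "z \<cdot> a = (a \<cdot> z \<cdot> a) \<cdot> x \<cdot> a \<cdot> a"
      unfolding aza by (use a x in \<open>simp add: z_def assoc\<close>)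
    also have "\<dots> = a \<cdot> z \<cdot> (z \<cdot> a)"
      using a x z by (simp add: z_def assoc)
    also have "\<dots> = a \<cdot> a \<cdot> x \<cdot> (a \<cdot> z \<cdot> a)"
      using a x z by (simp add: z_def assoc)
    also have "\<dots> = a \<cdot> z"
      unfolding aza by (use a x in \<open>simp add: z_def assoc\<close>)
    finally have za: "z \<cdot> a = a \<cdot> z" .
    define e where "e = a \<cdot> z"
    \<comment> \<open>The candidate inverse of \<open>a\<close>. The factor \<open>e\<close> makes
      it absorb \<open>e\<close> on the right by idempotence, and on the left because
      \<open>e\<close> commutes with \<open>z\<close>.\<close>
    define c where "c = z \<cdot> e"
    have e: "e \<in> carrier S" and c: "c \<in> carrier S"
      using a z by (simp_all add: e_def c_def)
    have ea: "e \<cdot> a = a" using aza by (simp add: e_def)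
    have ae: "a \<cdot> e = a" using aza assoc[of a z a] za a z e_def by metis
    have ee: "e \<cdot> e = e"
      using assoc[of e a z] ea a z e e_def by metis
    have ez: "e \<cdot> z = z \<cdot> e" using assoc[of z a z] a z za e_def by metis
    have "e \<cdot> c = c" using assoc[of e z e] assoc[of z e e] ee ez e z c_def by metis
    moreover have "c \<cdot> e = c" using ee e z by (simp add: c_def assoc)
    moreover have "a \<cdot> c = e" using assoc[of a z e] ee a e z c_def e_def by metis
    moreover have "c \<cdot> a = e" using assoc[of z e a] ea za a e z c_def e_def by metis
    ultimately have "a \<in> local_units e"
      unfolding local_units_def using a ea ae c by blast
    with is_subgroup_local_units[OF e ee] show "\<exists>H. is_subgroup H S \<and> a \<in> H" by blast
  qed
qed

section \<open>Simple and completely simple semigroups\<close>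

text \<open>The working form of simplicity, with both multipliers in \<open>S\<close> itself.
  Conversely, \<open>S b S = S\<close> makes every principal two-sided ideal the whole semigroup, so
  all of them coincide.\<close>

lemma simple_semigroup_iff:
  "simple_semigroup S \<longleftrightarrow>
    (\<forall>a\<in>carrier S. \<forall>b\<in>carrier S. \<exists>u\<in>carrier S. \<exists>v\<in>carrier S. a = u \<cdot> b \<cdot> v)"
proof
  assume simple: "simple_semigroup S"
  show "\<forall>a\<in>carrier S. \<forall>b\<in>carrier S. \<exists>u\<in>carrier S. \<exists>v\<in>carrier S. a = u \<cdot> b \<cdot> v"
  proof (intro ballI)
    fix a b assume a: "a \<in> carrier S" and b: "b \<in> carrier S"
    \<comment> \<open>\<open>S\<^sup>1 (b b b) S\<^sup>1\<close> lies in \<open>S b S\<close>, so no case distinction on adjoined identities is left.\<close>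
    have "(a, b \<cdot> b \<cdot> b) \<in> green_J S"
      using simple a closed[OF closed[OF b b] b] unfolding simple_semigroup_def by blast
    then have "two_sided_ideal S a = two_sided_ideal S (b \<cdot> b \<cdot> b)"
      by (simp add: green_J_def)
    moreover have "a \<in> two_sided_ideal S a" by (simp add: two_sided_ideal_def)
    ultimately have "a \<in> two_sided_ideal S (b \<cdot> b \<cdot> b)" by simp
    then consider "a = b \<cdot> b \<cdot> b"
      | x where "x \<in> carrier S" "a = (x \<cdot> b) \<cdot> b \<cdot> b"
      | y where "y \<in> carrier S" "a = b \<cdot> b \<cdot> (b \<cdot> y)"
      | x y where "x \<in> carrier S" "y \<in> carrier S" "a = (x \<cdot> b) \<cdot> b \<cdot> (b \<cdot> y)"
      unfolding two_sided_ideal_def using b by (auto simp: assoc)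
    then show "\<exists>u\<in>carrier S. \<exists>v\<in>carrier S. a = u \<cdot> b \<cdot> v"
      using b closed by cases blast+
  qed
next
  assume R: "\<forall>a\<in>carrier S. \<forall>b\<in>carrier S. \<exists>u\<in>carrier S. \<exists>v\<in>carrier S. a = u \<cdot> b \<cdot> v"
  have "two_sided_ideal S b = carrier S" if "b \<in> carrier S" for b
  proof
    show "two_sided_ideal S b \<subseteq> carrier S"
      unfolding two_sided_ideal_def using that closed by blast
    show "carrier S \<subseteq> two_sided_ideal S b"
      unfolding two_sided_ideal_def using R that by blast
  qed
  then show "simple_semigroup S"
    by (simp add: simple_semigroup_def green_J_def)
qed

text \<open>In the converse direction, \<open>b = a\<close> gives the equation for complete
  regularity, and bracketing as \<open>a b (x b a)\<close> puts \<open>a\<close> in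
  \<open>S b S\<close>.\<close>

lemma completely_simple_iff:
  "completely_simple S \<longleftrightarrow>
    (\<forall>a\<in>carrier S. \<forall>b\<in>carrier S. \<exists>x\<in>carrier S. a = a \<cdot> b \<cdot> x \<cdot> b \<cdot> a)"
proof
  assume C: "completely_simple S"
  have simple: "\<exists>u\<in>carrier S. \<exists>v\<in>carrier S. a = u \<cdot> b \<cdot> v"
    if "a \<in> carrier S" "b \<in> carrier S" for a b
    using C simple_semigroup_iff that unfolding completely_simple_def by blast
  have creg: "\<exists>x\<in>carrier S. a = a \<cdot> a \<cdot> x \<cdot> (a \<cdot> a)" if "a \<in> carrier S" for a
    using C completely_regular_iff that unfolding completely_simple_def by blast
  show "\<forall>a\<in>carrier S. \<forall>b\<in>carrier S. \<exists>x\<in>carrier S. a = a \<cdot> b \<cdot> x \<cdot> b \<cdot> a"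
  proof (intro ballI)
    fix a b assume a: "a \<in> carrier S" and b: "b \<in> carrier S"
    have "\<exists>s\<in>carrier S. a = a \<cdot> b \<cdot> s"
    proof -
      \<comment> \<open>Simplicity is applied to \<open>a b\<close> instead of \<open>b\<close>, so
        that \<open>a\<close> reappears on the right, between \<open>u\<close> and
        \<open>w = b v\<close>.\<close>
      obtain u v where uv: "u \<in> carrier S" "v \<in> carrier S" "a = u \<cdot> (a \<cdot> b) \<cdot> v"
        using simple[of a "a \<cdot> b"] a b by blast
      define w where "w = b \<cdot> v"
      have w: "w \<in> carrier S" using b uv by (simp add: w_def)
      have auw: "a = u \<cdot> a \<cdot> w" using a b uv by (simp add: w_def assoc)
      obtain x where x: "x \<in> carrier S" "w = w \<cdot> w \<cdot> x \<cdot> (w \<cdot> w)" using creg w by blast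
      \<comment> \<open>Once \<open>w\<close> is expanded, its first factor is absorbed by
        \<open>u a w = a\<close>; the next factor \<open>w\<close> supplies the required
        \<open>b\<close> directly after \<open>a\<close>.\<close>
      have "a = u \<cdot> a \<cdot> (w \<cdot> w \<cdot> x \<cdot> (w \<cdot> w))" using auw x(2) by simp
      also have "\<dots> = (u \<cdot> a \<cdot> w) \<cdot> (w \<cdot> x \<cdot> (w \<cdot> w))" using a uv(1) w x(1) by (simp add: assoc)
      also have "\<dots> = a \<cdot> (w \<cdot> x \<cdot> (w \<cdot> w))" using auw by simp
      also have "\<dots> = a \<cdot> b \<cdot> (v \<cdot> x \<cdot> (w \<cdot> w))" using a b uv(2) w x(1) by (simp add: w_def assoc)
      finally show ?thesis using uv(2) w x(1) by (intro bexI[of _ "v \<cdot> x \<cdot> (w \<cdot> w)"]) auto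
    qed
    then obtain s where s: "s \<in> carrier S" "a = a \<cdot> b \<cdot> s" by blast
    have "\<exists>t\<in>carrier S. a = t \<cdot> b \<cdot> a"
    proof -
      \<comment> \<open>The mirror image: now \<open>w = u b\<close> stands to the left of
        \<open>a\<close>, its last factor is absorbed by \<open>w a v = a\<close>, and the factor
        before it ends in \<open>b\<close>.\<close>
      obtain u v where uv: "u \<in> carrier S" "v \<in> carrier S" "a = u \<cdot> (b \<cdot> a) \<cdot> v"
        using simple[of a "b \<cdot> a"] a b by blast
      define w where "w = u \<cdot> b"
      have w: "w \<in> carrier S" using b uv by (simp add: w_def)
      have awv: "a = w \<cdot> a \<cdot> v" using a b uv by (simp add: w_def assoc)
      obtain x where x: "x \<in> carrier S" "w = w \<cdot> w \<cdot> x \<cdot> (w \<cdot> w)" using creg w by blast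
      have "a = (w \<cdot> w \<cdot> x \<cdot> (w \<cdot> w)) \<cdot> a \<cdot> v" using awv x(2) by simp
      also have "\<dots> = w \<cdot> w \<cdot> x \<cdot> w \<cdot> (w \<cdot> a \<cdot> v)" using a uv(2) w x(1) by (simp add: assoc)
      also have "\<dots> = w \<cdot> w \<cdot> x \<cdot> w \<cdot> a" using awv by simp
      also have "\<dots> = (w \<cdot> w \<cdot> x \<cdot> u) \<cdot> b \<cdot> a" using a b uv(1) w x(1) by (simp add: w_def assoc)
      finally show ?thesis using uv(1) w x(1) by (intro bexI[of _ "w \<cdot> w \<cdot> x \<cdot> u"]) auto
    qed
    then obtain t where t: "t \<in> carrier S" "a = t \<cdot> b \<cdot> a" by blast
    obtain x where x: "x \<in> carrier S" "a = a \<cdot> a \<cdot> x \<cdot> (a \<cdot> a)" using creg a by blast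
    \<comment> \<open>With \<open>a = a y a\<close>, the left \<open>a\<close> can be replaced by
      \<open>a b s\<close> and the right one by \<open>t b a\<close>.\<close>
    define y where "y = a \<cdot> x \<cdot> a"
    have y: "y \<in> carrier S" using a x(1) by (simp add: y_def)
    have "a = a \<cdot> y \<cdot> a" using a x by (simp add: y_def assoc)
    also have "\<dots> = (a \<cdot> b \<cdot> s) \<cdot> y \<cdot> (t \<cdot> b \<cdot> a)" using s(2) t(2) by simp
    also have "\<dots> = a \<cdot> b \<cdot> (s \<cdot> y \<cdot> t) \<cdot> b \<cdot> a" using a b s(1) t(1) y by (simp add: assoc)
    finally show "\<exists>x\<in>carrier S. a = a \<cdot> b \<cdot> x \<cdot> b \<cdot> a"
      using s(1) t(1) y by (intro bexI[of _ "s \<cdot> y \<cdot> t"]) auto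
  qed
next
  assume R: "\<forall>a\<in>carrier S. \<forall>b\<in>carrier S. \<exists>x\<in>carrier S. a = a \<cdot> b \<cdot> x \<cdot> b \<cdot> a"
  have "completely_regular S"
    unfolding completely_regular_iff
  proof
    fix a assume a: "a \<in> carrier S"
    with R obtain x where x: "x \<in> carrier S" "a = a \<cdot> a \<cdot> x \<cdot> a \<cdot> a" by blast
    then have "a = a \<cdot> a \<cdot> x \<cdot> (a \<cdot> a)" using a by (simp add: assoc)
    with x(1) show "\<exists>x\<in>carrier S. a = a \<cdot> a \<cdot> x \<cdot> (a \<cdot> a)" by blast
  qed
  moreover have "simple_semigroup S"
    unfolding simple_semigroup_iff
  proof (intro ballI)
    fix a b assume a: "a \<in> carrier S" and b: "b \<in> carrier S"
    with R obtain x where x: "x \<in> carrier S" "a = a \<cdot> b \<cdot> x \<cdot> b \<cdot> a" by blast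
    then have "a = a \<cdot> b \<cdot> (x \<cdot> b \<cdot> a)" using a b by (simp add: assoc)
    with a b x(1) show "\<exists>u\<in>carrier S. \<exists>v\<in>carrier S. a = u \<cdot> b \<cdot> v" by blast
  qed
  ultimately show "completely_simple S" by (simp add: completely_simple_def)
qed

end

section \<open>Equation systems and EHP-classes\<close>

text \<open>The class ranges over all semigroups on the type, so the equivalence is demanded for a
  variable \<open>T\<close>, and each use interprets the locale at \<open>T\<close>.\<close>

lemma EHP_class_by_singletonI:
  assumes "wf_system E" "\<And>T. is_semigroup T \<Longrightarrow> P T \<longleftrightarrow> satisfies T E"
  shows "EHP_class_by {E} {T. is_semigroup T \<and> P T}"
  using assms by (auto simp: EHP_class_by_def)

lemma EHP_class_by_regular:
  "EHP_class_by {Eq_System [Forall, Exists] [([0], [0, 1, 0])]}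
    {T. is_semigroup T \<and> regular T}"
proof (rule EHP_class_by_singletonI)
  fix T :: "'a magma" assume "is_semigroup T"
  then interpret magma_semigroup T by unfold_locales
  show "regular T \<longleftrightarrow> satisfies T (Eq_System [Forall, Exists] [([0], [0, 1, 0])])"
    \<comment> \<open>\<open>word_value\<close> brackets to the right, so \<open>assoc\<close> must
      be applied under the bounded quantifiers; the congruence rules supply the carrier membership
      it requires.\<close>
    unfolding regular_iff by (simp add: assoc cong: ball_cong bex_cong)
qed simp

text \<open>With two universal quantifiers, positions 0, 1 and 2 stand for \<open>a\<close>,
  \<open>b\<close> and \<open>x\<close>.\<close>

lemma EHP_class_by_left_group:
  "EHP_class_by {Eq_System [Forall, Forall, Exists] [([0], [0, 2, 1])]}
    {T. is_semigroup T \<and> left_group T}"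
proof (rule EHP_class_by_singletonI)
  fix T :: "'a magma" assume "is_semigroup T"
  then interpret magma_semigroup T by unfold_locales
  show "left_group T \<longleftrightarrow> satisfies T (Eq_System [Forall, Forall, Exists] [([0], [0, 2, 1])])"
    unfolding left_group_iff by (simp add: assoc cong: ball_cong bex_cong)
qed simp

lemma EHP_class_by_right_group:
  "EHP_class_by {Eq_System [Forall, Forall, Exists] [([0], [1, 2, 0])]}
    {T. is_semigroup T \<and> right_group T}"
proof (rule EHP_class_by_singletonI)
  fix T :: "'a magma" assume "is_semigroup T"
  then interpret magma_semigroup T by unfold_locales
  show "right_group T \<longleftrightarrow> satisfies T (Eq_System [Forall, Forall, Exists] [([0], [1, 2, 0])])"
    unfolding right_group_iff by (simp add: assoc cong: ball_cong bex_cong)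
qed simp

lemma EHP_class_by_group:
  "EHP_class_by {Eq_System [Forall, Forall, Exists] [([0], [1, 2, 1])]}
    {T. is_semigroup T \<and> is_group T}"
proof (rule EHP_class_by_singletonI)
  fix T :: "'a magma" assume "is_semigroup T"
  then interpret magma_semigroup T by unfold_locales
  show "is_group T \<longleftrightarrow> satisfies T (Eq_System [Forall, Forall, Exists] [([0], [1, 2, 1])])"
    unfolding group_iff by (simp add: assoc cong: ball_cong bex_cong)
qed simp

lemma EHP_class_by_completely_regular:
  "EHP_class_by {Eq_System [Forall, Exists] [([0], [0, 0, 1, 0, 0])]}
    {T. is_semigroup T \<and> completely_regular T}"
proof (rule EHP_class_by_singletonI)
  fix T :: "'a magma" assume "is_semigroup T"
  then interpret magma_semigroup T by unfold_locales
  show "completely_regular T \<longleftrightarrow>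
      satisfies T (Eq_System [Forall, Exists] [([0], [0, 0, 1, 0, 0])])"
    unfolding completely_regular_iff by (simp add: assoc cong: ball_cong bex_cong)
qed simp

lemma EHP_class_by_completely_simple:
  "EHP_class_by {Eq_System [Forall, Forall, Exists] [([0], [0, 1, 2, 1, 0])]}
    {T. is_semigroup T \<and> completely_simple T}"
proof (rule EHP_class_by_singletonI)
  fix T :: "'a magma" assume "is_semigroup T"
  then interpret magma_semigroup T by unfold_locales
  show "completely_simple T \<longleftrightarrow>
      satisfies T (Eq_System [Forall, Forall, Exists] [([0], [0, 1, 2, 1, 0])])"
    unfolding completely_simple_iff by (simp add: assoc cong: ball_cong bex_cong)
qed simp

theorem proposition2p1:
  fixes S :: "'a magma" (structure)
  assumes "is_semigroup S"
  shows "(regular S \<longleftrightarrow> (\<forall>a\<in>carrier S. \<exists>x\<in>carrier S. a = a \<cdot> x \<cdot> a)) \<and>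
    (left_group S \<longleftrightarrow> (\<forall>a\<in>carrier S. \<forall>b\<in>carrier S. \<exists>x\<in>carrier S. a = a \<cdot> x \<cdot> b)) \<and>
    (right_group S \<longleftrightarrow> (\<forall>a\<in>carrier S. \<forall>b\<in>carrier S. \<exists>x\<in>carrier S. a = b \<cdot> x \<cdot> a)) \<and>
    (is_group S \<longleftrightarrow> (\<forall>a\<in>carrier S. \<forall>b\<in>carrier S. \<exists>x\<in>carrier S. a = b \<cdot> x \<cdot> b)) \<and>
    (completely_regular S \<longleftrightarrow> (\<forall>a\<in>carrier S. \<exists>x\<in>carrier S. a = a \<cdot> a \<cdot> x \<cdot> (a \<cdot> a))) \<and>
    (completely_simple S \<longleftrightarrow> (\<forall>a\<in>carrier S. \<forall>b\<in>carrier S. \<exists>x\<in>carrier S. a = a \<cdot> b \<cdot> x \<cdot> b \<cdot> a)) \<and>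
    EHP_class_by {Eq_System [Forall, Exists] [([0], [0, 1, 0])]}
           {T :: 'a magma. is_semigroup T \<and> regular T} \<and>
    EHP_class_by {Eq_System [Forall, Forall, Exists] [([0], [0, 2, 1])]}
           {T :: 'a magma. is_semigroup T \<and> left_group T} \<and>
    EHP_class_by {Eq_System [Forall, Forall, Exists] [([0], [1, 2, 0])]}
           {T :: 'a magma. is_semigroup T \<and> right_group T} \<and>
    EHP_class_by {Eq_System [Forall, Forall, Exists] [([0], [1, 2, 1])]}
           {T :: 'a magma. is_semigroup T \<and> is_group T} \<and>
    EHP_class_by {Eq_System [Forall, Exists] [([0], [0, 0, 1, 0, 0])]}
           {T :: 'a magma. is_semigroup T \<and> completely_regular T} \<and>
    EHP_class_by {Eq_System [Forall, Forall, Exists] [([0], [0, 1, 2, 1, 0])]}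
           {T :: 'a magma. is_semigroup T \<and> completely_simple T} \<and>
    EHP_class {T :: 'a magma. is_semigroup T \<and> regular T} \<and>
    EHP_class {T :: 'a magma. is_semigroup T \<and> left_group T} \<and>
    EHP_class {T :: 'a magma. is_semigroup T \<and> right_group T} \<and>
    EHP_class {T :: 'a magma. is_semigroup T \<and> is_group T} \<and>
    EHP_class {T :: 'a magma. is_semigroup T \<and> completely_regular T} \<and>
    EHP_class {T :: 'a magma. is_semigroup T \<and> completely_simple T}"
proof -
  interpret magma_semigroup S using assms by unfold_locales
  note EHP = EHP_class_by_regular EHP_class_by_left_group EHP_class_by_right_group
    EHP_class_by_group EHP_class_by_completely_regular EHP_class_by_completely_simple
  \<comment> \<open>The bare \<open>EHP_class\<close> claims only forget the defining
    system.\<close>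
  have EHP_classI: "EHP_class C" if "EHP_class_by \<Sigma> C" for \<Sigma> and C :: "'a magma set"
    using that unfolding EHP_class_def by blast
  show ?thesis
    by (intro conjI regular_iff left_group_iff right_group_iff group_iff completely_regular_iff
        completely_simple_iff EHP EHP[THEN EHP_classI])
qed

end
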